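(* Let $G$ be a finite group, $S\subseteq G\setminus\{1\}$ a symmetric generating set ($S=S^{-1}$, $1\notin S$), $\mathbb{K}$ a field, and $h>0$ real. The Cayley evolution algebra $\mathcal{C}(G,S,\mathbb{K})$ is an $h$-EEA if and only if the Cayley graph $\mathrm{Cay}(G,S)$ is an $h$-expander.
   Context: An evolution algebra over $\mathbb{K}$ (finite-dimensional) is an algebra $E$ with a linear basis $\mathcal{B}=\{e_i\}_{i\in\Lambda}$, $\Lambda$ finite (a natural basis), such that $e_ie_j=0$ for $i\neq j$ and $e_i^2=\sum_k a_{ik}e_k$ with $a_{ik}\in\mathbb{K}$. The graph $\Gamma(E,\mathcal{B})$ is the simple graph with vertex set $\Lambda$ and edges $\{i,j\}$, $i\ne j$, whenever $a_{ij}\neq0$ or $a_{ji}\ne0$. For a finite simple graph $\Gamma$ with vertex set $V$ and $W\subseteq V$, let $E(W)$ be the set of edges with exactly one endpoint in $W$; the Cheeger constant is $\mathfrak{h}(\Gamma)=\min\{|E(W)|/|W| : \emptyset\ne W\subsetneq V,\ |W|\le |V|/2\}$, with $\mathfrak{h}(\Gamma)=+\infty$ if $|V|\le1$. $E$ is an $h$-EEA ($h$-Expander Evolution Algebra) if $\mathfrak{h}(\Gamma(E,\mathcal{B}))\ge h$. A finite connected graph $\Gamma$ is an $h$-expander if $\mathfrak{h}(\Gamma)\ge h$. The Cayley evolution algebra $\mathcal{C}(G,S,\mathbb{K})$ has natural basis $\{e_g:g\in G\}$ and $e_g^2=\sum_{s\in S}e_{gs}$. The Cayley graph $\mathrm{Cay}(G,S)$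 has vertex set $G$ and edges $\{g,gs\}$ for $g\in G$, $s\in S$. *)

theory Defs
  imports Complex_Main "HOL-Algebra.Generated_Groups" "HOL-Library.Function_Algebras"
    "HOL-Library.Extended_Real"
begin

section \<open>Finite simple graphs, Cheeger constant, expanders\<close>

text \<open>A graph is given by its vertex set and its set of (unordered, two-element) edges.\<close>

type_synonym 'a graph = "'a set \<times> 'a set set"

abbreviation verts :: "'a graph \<Rightarrow> 'a set" where "verts \<equiv> fst"
abbreviation edges :: "'a graph \<Rightarrow> 'a set set" where "edges \<equiv> snd"

definition finite_simple_graph :: "'a graph \<Rightarrow> bool" where
  "finite_simple_graph \<Gamma> \<longleftrightarrow>
     finite (verts \<Gamma>) \<and> (\<forall>\<epsilon>\<in>edges \<Gamma>. \<epsilon> \<subseteq> verts \<Gamma> \<and> card \<epsilon> = 2)"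

definition connected_graph :: "'a graph \<Rightarrow> bool" where
  "connected_graph \<Gamma> \<longleftrightarrow>
     (\<forall>u\<in>verts \<Gamma>. \<forall>v\<in>verts \<Gamma>. (u, v) \<in> {(x, y). {x, y} \<in> edges \<Gamma>}\<^sup>*)"

definition edge_boundary :: "'a graph \<Rightarrow> 'a set \<Rightarrow> 'a set set" where
  "edge_boundary \<Gamma> W = {\<epsilon> \<in> edges \<Gamma>. card (\<epsilon> \<inter> W) = 1}"

definition cheeger :: "'a graph \<Rightarrow> ereal" where
  "cheeger \<Gamma> =
     (if card (verts \<Gamma>) \<le> 1 then \<infinity>
      else Min {ereal (real (card (edge_boundary \<Gamma> W)) / real (card W)) | W.
                  W \<noteq> {} \<and> W \<subset> verts \<Gamma> \<and> real (card W) \<le> real (card (verts \<Gamma>)) / 2})"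

definition expander_graph :: "real \<Rightarrow> 'a graph \<Rightarrow> bool" where
  "expander_graph h \<Gamma> \<longleftrightarrow>
     finite_simple_graph \<Gamma> \<and> connected_graph \<Gamma> \<and> cheeger \<Gamma> \<ge> ereal h"


section \<open>Evolution algebras\<close>

text \<open>
  A (not necessarily associative or unital) algebra is carried by a subspace \<open>vecs A\<close> of a
  type of vectors, so that its basis may be indexed by a set which is not a whole type.
  Addition and zero are those of the type.
\<close>

record ('k, 'v) alg =
  vecs :: "'v set"
  scl :: "'k \<Rightarrow> 'v \<Rightarrow> 'v"
  mul :: "'v \<Rightarrow> 'v \<Rightarrow> 'v"

definition is_algebra :: "('k::field, 'v::ab_group_add) alg \<Rightarrow> bool" where
  "is_algebra A \<longleftrightarrow>
     vector_space (scl A) \<and> module.subspace (scl A) (vecs A) \<and>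
     (\<forall>x\<in>vecs A. \<forall>y\<in>vecs A. mul A x y \<in> vecs A) \<and>
     (\<forall>x\<in>vecs A. \<forall>y\<in>vecs A. \<forall>z\<in>vecs A.
        mul A (x + y) z = mul A x z + mul A y z \<and>
        mul A z (x + y) = mul A z x + mul A z y) \<and>
     (\<forall>c. \<forall>x\<in>vecs A. \<forall>y\<in>vecs A.
        mul A (scl A c x) y = scl A c (mul A x y) \<and>
        mul A x (scl A c y) = scl A c (mul A x y))"

text \<open>
  No condition on the squares \<open>e i\<^sup>2\<close> is needed: they lie in \<open>vecs A\<close>, hence are linear
  combinations of the basis.
\<close>

definition natural_basis ::
  "('k::field, 'v::ab_group_add) alg \<Rightarrow> 'i set \<Rightarrow> ('i \<Rightarrow> 'v) \<Rightarrow> bool" where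
  "natural_basis A \<Lambda> e \<longleftrightarrow>
     finite \<Lambda> \<and> inj_on e \<Lambda> \<and>
     \<not> module.dependent (scl A) (e ` \<Lambda>) \<and> module.span (scl A) (e ` \<Lambda>) = vecs A \<and>
     (\<forall>i\<in>\<Lambda>. \<forall>j\<in>\<Lambda>. i \<noteq> j \<longrightarrow> mul A (e i) (e j) = 0)"

text \<open>The coefficient \<open>a\<^sub>i\<^sub>k\<close> of \<open>e k\<close> in \<open>e i\<^sup>2\<close>.\<close>

definition structure_const ::
  "('k::field, 'v::ab_group_add) alg \<Rightarrow> 'i set \<Rightarrow> ('i \<Rightarrow> 'v) \<Rightarrow> 'i \<Rightarrow> 'i \<Rightarrow> 'k" where
  "structure_const A \<Lambda> e i k =
     module.representation (scl A) (e ` \<Lambda>) (mul A (e i) (e i)) (e k)"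

definition evolution_graph ::
  "('k::field, 'v::ab_group_add) alg \<Rightarrow> 'i set \<Rightarrow> ('i \<Rightarrow> 'v) \<Rightarrow> 'i graph" where
  "evolution_graph A \<Lambda> e =
     (\<Lambda>, {{i, j} | i j. i \<in> \<Lambda> \<and> j \<in> \<Lambda> \<and> i \<noteq> j \<and>
            (structure_const A \<Lambda> e i j \<noteq> 0 \<or> structure_const A \<Lambda> e j i \<noteq> 0)})"

text \<open>
  The graph, and with it the expansion property, depends on the natural basis, so the
  basis is part of the data.
\<close>

definition expander_evolution_algebra ::
  "real \<Rightarrow> ('k::field, 'v::ab_group_add) alg \<Rightarrow> 'i set \<Rightarrow> ('i \<Rightarrow> 'v) \<Rightarrow> bool" where
  "expander_evolution_algebra h A \<Lambda> e \<longleftrightarrow>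
     is_algebra A \<and> natural_basis A \<Lambda> e \<and> cheeger (evolution_graph A \<Lambda> e) \<ge> ereal h"


section \<open>Cayley graphs and Cayley evolution algebras\<close>

definition cayley_graph :: "('g, 'm) monoid_scheme \<Rightarrow> 'g set \<Rightarrow> 'g graph" where
  "cayley_graph G S = (carrier G, {{g, g \<otimes>\<^bsub>G\<^esub> s} | g s. g \<in> carrier G \<and> s \<in> S})"

definition cayley_basis :: "'g \<Rightarrow> 'g \<Rightarrow> 'k::field" where
  "cayley_basis g = (\<lambda>x. if x = g then 1 else 0)"

text \<open>
  The free vector space on \<open>carrier G\<close>, realised as the functions vanishing off \<open>carrier G\<close>,
  with the bilinear extension of \<open>e\<^sub>g e\<^sub>g = (\<Sum>s\<in>S. e\<^sub>g\<^sub>s)\<close> and \<open>e\<^sub>g e\<^sub>h = 0\<close> for \<open>g \<noteq> h\<close>.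
\<close>

definition cayley_evolution_algebra ::
  "('g, 'm) monoid_scheme \<Rightarrow> 'g set \<Rightarrow> ('k::field, 'g \<Rightarrow> 'k) alg" where
  "cayley_evolution_algebra G S =
     \<lparr>vecs = {f. \<forall>x. x \<notin> carrier G \<longrightarrow> f x = 0},
      scl = (\<lambda>c f x. c * f x),
      mul = (\<lambda>f f' x. \<Sum>g\<in>carrier G. f g * f' g * (\<Sum>s\<in>S. cayley_basis (g \<otimes>\<^bsub>G\<^esub> s) x))\<rparr>"

end

theory Submission
  imports Defs
begin

text \<open>
  Left translation is injective, so the square of a basis vector \<open>e g\<close> is a sum of distinct
  basis vectors: its structure constants are 0 and 1, in whatever characteristic, and the
  graph of the algebra is the Cayley graph. Expansion of a graph also asks for
  connectedness, which holds because \<open>S\<close> generates \<open>G\<close>.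
\<close>

section \<open>Delta functions as a basis of a function space\<close>

abbreviation (input) pointwise_scale :: "'k::field \<Rightarrow> ('g \<Rightarrow> 'k) \<Rightarrow> 'g \<Rightarrow> 'k" where
  "pointwise_scale \<equiv> \<lambda>c f x. c * f x"

text \<open>The scaling is the same term as the \<open>scl\<close> field of
  \<open>cayley_evolution_algebra\<close>, so once that field is unfolded, the \<open>module\<close>
  constants in \<open>natural_basis\<close> become the \<open>pointwise\<close> ones.\<close>

interpretation pointwise: vector_space "pointwise_scale :: 'k::field \<Rightarrow> ('g \<Rightarrow> 'k) \<Rightarrow> 'g \<Rightarrow> 'k"
  by unfold_locales (auto simp: fun_eq_iff algebra_simps)

lemma sum_fun_apply: "(\<Sum>i\<in>I. f i) x = (\<Sum>i\<in>I. f i x)"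
  for f :: "'i \<Rightarrow> 'a \<Rightarrow> 'b::comm_monoid_add"
  by (induction I rule: infinite_finite_induct) auto

lemma inj_cayley_basis: "inj (cayley_basis :: 'g \<Rightarrow> 'g \<Rightarrow> 'k::field)"
  by (rule injI) (metis cayley_basis_def zero_neq_one)

lemma cayley_basis_eq_iff [simp]:
  "(cayley_basis g :: 'g \<Rightarrow> 'k::field) = cayley_basis h \<longleftrightarrow> g = h"
  by (simp add: inj_eq inj_cayley_basis)

text \<open>Only the summand with g = x survives evaluation at x. Independence and spanning of the
  delta functions both reduce to this.\<close>

lemma sum_mult_cayley_basis:
  fixes c :: "'g \<Rightarrow> 'k::field"
  assumes "finite A"
  shows "(\<Sum>g\<in>A. c g * cayley_basis g x) = (if x \<in> A then c x else 0)"
proof -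
  have "(\<Sum>g\<in>A. c g * cayley_basis g x) = (\<Sum>g\<in>A. if x = g then c g else 0)"
    by (rule sum.cong) (auto simp: cayley_basis_def)
  then show ?thesis using assms by simp
qed

lemma independent_cayley_basis:
  assumes "finite A"
  shows "pointwise.independent ((cayley_basis :: 'g \<Rightarrow> 'g \<Rightarrow> 'k::field) ` A)"
proof (rule pointwise.independent_if_scalars_zero)
  show "finite ((cayley_basis :: 'g \<Rightarrow> 'g \<Rightarrow> 'k) ` A)" using assms by simp
next
  fix c :: "('g \<Rightarrow> 'k) \<Rightarrow> 'k" and v :: "'g \<Rightarrow> 'k"
  assume sum0: "(\<Sum>b\<in>cayley_basis ` A. pointwise_scale (c b) b) = 0"
    and "v \<in> cayley_basis ` A"
  then obtain x where x: "x \<in> A" "v = cayley_basis x" by blast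
  \<comment> \<open>Evaluating the vanishing combination at x isolates one coefficient; injectivity
    of \<open>cayley_basis\<close> lets the sum be indexed by A itself.\<close>
  have "0 = (\<Sum>g\<in>A. pointwise_scale (c (cayley_basis g)) (cayley_basis g)) x"
    using sum0 by (simp add: sum.reindex inj_on_def)
  also have "\<dots> = c v"
    using x assms by (simp add: sum_fun_apply sum_mult_cayley_basis)
  finally show "c v = 0" by simp
qed

lemma subspace_vanishing_off:
  "pointwise.subspace {f :: 'g \<Rightarrow> 'k::field. \<forall>x. x \<notin> A \<longrightarrow> f x = 0}"
  by (simp add: pointwise.subspace_def)

lemma span_cayley_basis:
  assumes "finite A"
  shows "pointwise.span (cayley_basis ` A) = {f :: 'g \<Rightarrow> 'k::field. \<forall>x. x \<notin> A \<longrightarrow> f x = 0}"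
    (is "_ = ?V")
proof
  show "pointwise.span (cayley_basis ` A) \<subseteq> ?V"
    by (rule pointwise.span_minimal[OF _ subspace_vanishing_off])
       (auto simp: cayley_basis_def)
  show "?V \<subseteq> pointwise.span (cayley_basis ` A)"
  proof
    fix f assume "f \<in> ?V"
    \<comment> \<open>The coordinates of f are its own values.\<close>
    then have "f = (\<Sum>g\<in>A. pointwise_scale (f g) (cayley_basis g))"
      using assms by (auto simp: fun_eq_iff sum_fun_apply sum_mult_cayley_basis)
    also have "\<dots> \<in> pointwise.span (cayley_basis ` A)"
      by (intro pointwise.span_sum pointwise.span_scale pointwise.span_base) auto
    finally show "f \<in> pointwise.span (cayley_basis ` A)" .
  qed
qed

section \<open>The Cayley evolution algebra and its natural basis\<close>

context group
begin

lemma is_algebra_cayley_evolution_algebra: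
  assumes "S \<subseteq> carrier G"
  shows "is_algebra (cayley_evolution_algebra G S :: ('k::field, 'a \<Rightarrow> 'k) alg)"
proof -
  \<comment> \<open>This closes \<open>vecs\<close> under \<open>mul\<close>: translates stay in the
    carrier, so products vanish off it.\<close>
  have "cayley_basis (g \<otimes> s) x = (0::'k)" if "g \<in> carrier G" "s \<in> S" "x \<notin> carrier G" for g s x
    using that assms by (auto simp: cayley_basis_def)
  then show ?thesis
    unfolding is_algebra_def cayley_evolution_algebra_def
    by (auto simp: pointwise.vector_space_axioms subspace_vanishing_off fun_eq_iff
        sum.distrib[symmetric] sum_distrib_left algebra_simps intro!: sum.neutral sum.cong)
qed

lemma mul_cayley_basis:
  assumes "finite (carrier G)" "g \<in> carrier G" "h \<in> carrier G"
  shows "mul (cayley_evolution_algebra G S :: ('k::field, 'a \<Rightarrow> 'k) alg)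
           (cayley_basis g) (cayley_basis h) = (if g = h then \<Sum>s\<in>S. cayley_basis (g \<otimes> s) else 0)"
proof
  fix x
  let ?sq = "\<lambda>k. \<Sum>s\<in>S. cayley_basis (k \<otimes> s) x :: 'k"
  \<comment> \<open>The product of the two deltas at k vanishes unless k = g = h, so at most one
    square remains.\<close>
  have "(\<Sum>k\<in>carrier G. cayley_basis g k * cayley_basis h k * ?sq k)
      = (\<Sum>k\<in>carrier G. if k = g then (if g = h then ?sq g else 0) else 0)"
    by (rule sum.cong) (auto simp: cayley_basis_def)
  then show "mul (cayley_evolution_algebra G S) (cayley_basis g) (cayley_basis h) x
      = (if g = h then \<Sum>s\<in>S. cayley_basis (g \<otimes> s) else 0 :: 'a \<Rightarrow> 'k) x"
    using assms by (simp add: cayley_evolution_algebra_def sum_fun_apply)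
qed

lemma natural_basis_cayley_basis:
  assumes "finite (carrier G)"
  shows "natural_basis (cayley_evolution_algebra G S :: ('k::field, 'a \<Rightarrow> 'k) alg)
           (carrier G) cayley_basis"
proof -
  have "scl (cayley_evolution_algebra G S :: ('k, 'a \<Rightarrow> 'k) alg) = pointwise_scale"
    "vecs (cayley_evolution_algebra G S :: ('k, 'a \<Rightarrow> 'k) alg)
       = {f. \<forall>x. x \<notin> carrier G \<longrightarrow> f x = 0}"
    by (simp_all add: cayley_evolution_algebra_def)
  then show ?thesis
    using assms
    by (simp add: natural_basis_def mul_cayley_basis independent_cayley_basis
        span_cayley_basis inj_on_def)
qed

section \<open>Structure constants and the graph of the algebra\<close>

lemma structure_const_cayley_evolution_algebra:
  assumes fin: "finite (carrier G)" and S: "S \<subseteq> carrier G"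
    and g: "g \<in> carrier G" and k: "k \<in> carrier G"
  shows "structure_const (cayley_evolution_algebra G S :: ('k::field, 'a \<Rightarrow> 'k) alg)
           (carrier G) cayley_basis g k = (if inv g \<otimes> k \<in> S then 1 else 0)"
proof -
  let ?B = "(cayley_basis :: 'a \<Rightarrow> 'a \<Rightarrow> 'k) ` carrier G"
  have in_B: "cayley_basis (g \<otimes> s) \<in> ?B" if "s \<in> S" for s
    using that g S by blast
  note indep = independent_cayley_basis[OF fin, where 'k = 'k]
  have "structure_const (cayley_evolution_algebra G S :: ('k, 'a \<Rightarrow> 'k) alg)
          (carrier G) cayley_basis g k
      = pointwise.representation ?B (\<Sum>s\<in>S. cayley_basis (g \<otimes> s)) (cayley_basis k)"
    using mul_cayley_basis[OF fin g g, of S, where 'k = 'k]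
    \<comment> \<open>The square is rewritten while \<open>mul\<close> is still folded; only then is
      the record unfolded, to expose pointwise scaling.\<close>
    by (simp add: structure_const_def) (simp add: cayley_evolution_algebra_def)
  also have "\<dots> = (\<Sum>s\<in>S. pointwise.representation ?B (cayley_basis (g \<otimes> s)) (cayley_basis k))"
    by (subst pointwise.representation_sum[OF indep]) (auto intro: pointwise.span_base in_B)
  also have "\<dots> = (\<Sum>s\<in>S. if k = g \<otimes> s then 1 else 0)"
    by (rule sum.cong) (auto simp: pointwise.representation_basis[OF indep in_B])
  \<comment> \<open>Cancellation gives a single candidate for s, so no multiplicity arises that
    could vanish in positive characteristic.\<close>
  also have "\<dots> = (\<Sum>s\<in>S. if s = inv g \<otimes> k then 1 else 0)"
    using g k S by (intro sum.cong) (auto simp: inv_solve_left subset_iff)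
  also have "\<dots> = (if inv g \<otimes> k \<in> S then 1 else 0)"
    using finite_subset[OF S fin] by simp
  finally show ?thesis .
qed

lemma evolution_graph_cayley_evolution_algebra:
  assumes "finite (carrier G)" and S: "S \<subseteq> carrier G - {\<one>}"
  shows "evolution_graph (cayley_evolution_algebra G S :: ('k::field, 'a \<Rightarrow> 'k) alg)
           (carrier G) cayley_basis = cayley_graph G S"
proof -
  have const_nz: "structure_const (cayley_evolution_algebra G S :: ('k, 'a \<Rightarrow> 'k) alg)
      (carrier G) cayley_basis g k \<noteq> 0 \<longleftrightarrow> inv g \<otimes> k \<in> S"
    if "g \<in> carrier G" "k \<in> carrier G" for g k
    using that assms by (subst structure_const_cayley_evolution_algebra) auto
  have "{{i, j} | i j. i \<in> carrier G \<and> j \<in> carrier G \<and> i \<noteq> j \<and> (inv i \<otimes> j \<in> S \<or> inv j \<otimes> i \<in> S)}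
      = {{g, g \<otimes> s} | g s. g \<in> carrier G \<and> s \<in> S}" (is "?L = ?R")
  proof
    \<comment> \<open>The generator leading from i to j is \<open>inv i \<otimes> j\<close>. Since
      edges are unordered, the other disjunct of \<open>?L\<close> is this fact with i and j
      swapped.\<close>
    have edge: "{i, j} \<in> ?R" if "i \<in> carrier G" "j \<in> carrier G" "inv i \<otimes> j \<in> S" for i j
    proof -
      have "{i, j} = {i, i \<otimes> (inv i \<otimes> j)}"
        using that by (simp add: m_assoc[symmetric])
      then show ?thesis using that by blast
    qed
    show "?L \<subseteq> ?R"
    proof
      fix \<epsilon> assume "\<epsilon> \<in> ?L"
      then obtain i j where "\<epsilon> = {i, j}" "i \<in> carrier G" "j \<in> carrier G"
        "inv i \<otimes> j \<in> S \<or> inv j \<otimes> i \<in> S" by blast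
      then show "\<epsilon> \<in> ?R" using edge[of i j] edge[of j i] by (metis insert_commute)
    qed
    show "?R \<subseteq> ?L"
    proof
      fix \<epsilon> assume "\<epsilon> \<in> ?R"
      then obtain g s where "\<epsilon> = {g, g \<otimes> s}" "g \<in> carrier G" "s \<in> S" by blast
      \<comment> \<open>Here \<open>\<one> \<notin> S\<close> matches the condition
        \<open>i \<noteq> j\<close> of the evolution graph.\<close>
      moreover from this S have "g \<otimes> s \<in> carrier G" "g \<noteq> g \<otimes> s" "inv g \<otimes> (g \<otimes> s) \<in> S"
        by (auto simp: m_assoc[symmetric] subset_iff)
      ultimately show "\<epsilon> \<in> ?L" by blast
    qed
  qed
  moreover have "{{i, j} | i j. i \<in> carrier G \<and> j \<in> carrier G \<and> i \<noteq> j \<and>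
       (structure_const (cayley_evolution_algebra G S :: ('k, 'a \<Rightarrow> 'k) alg) (carrier G) cayley_basis i j \<noteq> 0
      \<or> structure_const (cayley_evolution_algebra G S :: ('k, 'a \<Rightarrow> 'k) alg) (carrier G) cayley_basis j i \<noteq> 0)}
     = {{i, j} | i j. i \<in> carrier G \<and> j \<in> carrier G \<and> i \<noteq> j \<and> (inv i \<otimes> j \<in> S \<or> inv j \<otimes> i \<in> S)}"
    by (intro Collect_cong ex_cong1) (use const_nz in blast)
  ultimately show ?thesis by (simp add: evolution_graph_def cayley_graph_def)
qed

section \<open>Simplicity and connectedness of the Cayley graph\<close>

lemma finite_simple_graph_cayley_graph:
  assumes "finite (carrier G)" and "S \<subseteq> carrier G - {\<one>}"
  shows "finite_simple_graph (cayley_graph G S)"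
proof -
  \<comment> \<open>Since \<open>\<one> \<notin> S\<close>, no edge degenerates to a
    singleton.\<close>
  have "g \<otimes> s \<in> carrier G \<and> card {g, g \<otimes> s} = 2" if "g \<in> carrier G" "s \<in> S" for g s
    using that assms by (auto simp: card_2_iff subset_iff)
  then show ?thesis
    using assms by (auto simp: finite_simple_graph_def cayley_graph_def)
qed

lemma connected_cayley_graph:
  assumes S: "S \<subseteq> carrier G" and gen: "generate G S = carrier G"
  shows "connected_graph (cayley_graph G S)"
proof -
  let ?R = "{(x, y). {x, y} \<in> edges (cayley_graph G S)}"
  have edge: "(u, u \<otimes> s) \<in> ?R" if "u \<in> carrier G" "s \<in> S" for u s
    using that by (auto simp: cayley_graph_def)
  \<comment> \<open>The start vertex is quantified because in the product case the second path
    starts at \<open>u \<otimes> g\<close>.\<close>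
  have "\<forall>u\<in>carrier G. (u, u \<otimes> g) \<in> ?R\<^sup>*" if "g \<in> generate G S" for g
    using that
  proof (induction g rule: generate.induct)
    case one
    then show ?case by simp
  next
    case (incl s)
    then show ?case using edge by blast
  next
    case (inv s)
    show ?case
    proof
      fix u assume u: "u \<in> carrier G"
      have s: "s \<in> carrier G" using inv S by blast
      \<comment> \<open>An inverse generator is a step along s taken backwards: the edge leaving
        \<open>u \<otimes> inv s\<close> along s ends at u.\<close>
      with u inv have "(u \<otimes> inv s, u \<otimes> inv s \<otimes> s) \<in> ?R" by (intro edge) auto
      then have "(u, u \<otimes> inv s) \<in> ?R" using u s by (simp add: m_assoc insert_commute)
      then show "(u, u \<otimes> inv s) \<in> ?R\<^sup>*" by blast
    qed
  next
    case (eng g k)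
    show ?case
    proof
      fix u assume u: "u \<in> carrier G"
      have gk: "g \<in> carrier G" "k \<in> carrier G" using eng.hyps gen by auto
      have "(u, u \<otimes> g) \<in> ?R\<^sup>*" using eng.IH(1) u by blast
      also have "(u \<otimes> g, u \<otimes> g \<otimes> k) \<in> ?R\<^sup>*" using eng.IH(2) u gk by blast
      finally show "(u, u \<otimes> (g \<otimes> k)) \<in> ?R\<^sup>*" using u gk by (simp add: m_assoc)
    qed
  qed
  then have translate: "(u, u \<otimes> g) \<in> ?R\<^sup>*" if "u \<in> carrier G" "g \<in> carrier G" for u g
    using that gen by blast
  have "(u, v) \<in> ?R\<^sup>*" if "u \<in> carrier G" "v \<in> carrier G" for u v
    using translate[of u "inv u \<otimes> v"] that by (simp add: m_assoc[symmetric])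
  moreover have "verts (cayley_graph G S) = carrier G" by (simp add: cayley_graph_def)
  ultimately show ?thesis by (simp add: connected_graph_def)
qed

end

theorem theorem9p3:
  fixes G :: "('g, 'm) monoid_scheme" (structure)
    and S :: "'g set"
    and h :: real
  assumes "group G"
    and "finite (carrier G)"
    and "S \<subseteq> carrier G - {\<one>}"
    and "(\<lambda>s. inv s) ` S = S"
    and "generate G S = carrier G"
    and "h > 0"
  shows "expander_evolution_algebra h
           (cayley_evolution_algebra G S :: ('k::field, 'g \<Rightarrow> 'k) alg) (carrier G) cayley_basis
         \<longleftrightarrow> expander_graph h (cayley_graph G S)"
proof -
  interpret group G by fact
  have "S \<subseteq> carrier G" using assms(3) by blast
  \<comment> \<open>With the two graphs equal, both sides contain the same Cheeger bound. The other
    conjuncts, algebra and natural basis on the left, simplicity and connectedness on the right,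
    hold outright.\<close>
  then show ?thesis
    using assms(2,3,5)
    by (simp add: expander_evolution_algebra_def expander_graph_def
        is_algebra_cayley_evolution_algebra natural_basis_cayley_basis
        evolution_graph_cayley_evolution_algebra finite_simple_graph_cayley_graph
        connected_cayley_graph)
qed

end
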